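(* For terms $\tau_1,\tau_2$ write $\mathsf{notC}(\tau_1,\tau_2)$ for $c(\tau_1)\wedge c(\tau_2)\wedge\neg c(\tau_1+\tau_2)$. Let $\phi^c_\infty$ be the $\mathcal{B}c$-formula in the variables $r_i,r'_i,s_i,t_i$ ($0\le i\le 3$), $s$, $t$, that is the conjunction of the following, with indices modulo 4 and $[k]=k\bmod 4$: (1) $r_0+r_1+r_2+r_3=1$, $r_i\cdot r_j=0$ for $0\le i<j\le 3$, $r_i\ne 0$ for $0\le i\le 3$; (2) for $i\in\{0,1\}$: $\mathsf{notC}(r_i\cdot(-r'_i)+t,\ r'_{i+2}+s)$, $\mathsf{notC}(r'_i+s,\ r_{i+2}\cdot(-r'_{i+2})+t)$, $\mathsf{notC}(r'_i+s_i,\ r'_{i+2}+s_{i+2})$, $\mathsf{notC}(r_i\cdot(-r'_i)+t_i,\ r_{i+2}\cdot(-r'_{i+2})+t_{i+2})$; (3) $r'_i\ne 0$ and $r'_i\le r_i$ for $0\le i\le 3$, and $t\ne 0$; (4) $c(r'_i+r_{[i+1]}+t)$ for $0\le i\le 3$; (5) $\mathsf{notC}(r'_0+r'_1+r'_2+r'_3,\ t)$; (6) $\mathsf{notC}(r'_i+s,\ r_{[i+1]}\cdot(-r'_{[i+1]})+t)$ for $0\le i\le 3$. Then $\phi^c_\infty$ is satisfiable over ${\sf RC}(\mathbb{R}^n)$ for every $n\ge 2$. On the other hand, if $T$ is a locally connected, unicoherent topological space, then in any interpretation over $(T,{\sf RC}(T))$ satisfying $\phi^c_\infty$, at least one variable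 is assigned a set with infinitely many connected components.
   Context: For a topological space $T$, ${\sf RC}(T)$ is the Boolean algebra of regular closed subsets of $T$ with $X+Y=X\cup Y$, $X\cdot Y=\overline{\mathrm{int}(X\cap Y)}$, $-X=\overline{T\setminus X}$, $0=\emptyset$, $1=T$. Terms are built from variables using $+,\cdot,-,0,1$. The language $\mathcal{B}c$ has atomic formulas $\tau_1=\tau_2$ and $c(\tau)$, closed under Boolean connectives; $\tau\ne 0$ abbreviates $\neg(\tau=0)$ and $\tau_1\le\tau_2$ abbreviates $\tau_1\cdot\tau_2=\tau_1$. In an interpretation assigning elements of ${\sf RC}(T)$ to variables, $c(\tau)$ holds iff the value of $\tau$ is connected. Satisfiable over ${\sf RC}(\mathbb{R}^n)$ means true in some interpretation over ${\sf RC}(\mathbb{R}^n)$. Locally connected: every neighbourhood of each point includes a connected neighbourhood of it. Unicoherent: for closed connected $X_1,X_2$ with $T=X_1\cup X_2$, $X_1\cap X_2$ is connected. *)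

theory Defs
  imports "HOL-Analysis.Analysis"
begin

definition regular_closed_in :: "'a topology \<Rightarrow> 'a set \<Rightarrow> bool" where
  "regular_closed_in T X \<longleftrightarrow> X \<subseteq> topspace T \<and> T closure_of (T interior_of X) = X"

definition rc_plus :: "'a topology \<Rightarrow> 'a set \<Rightarrow> 'a set \<Rightarrow> 'a set" where
  "rc_plus T X Y = X \<union> Y"

definition rc_times :: "'a topology \<Rightarrow> 'a set \<Rightarrow> 'a set \<Rightarrow> 'a set" where
  "rc_times T X Y = T closure_of (T interior_of (X \<inter> Y))"

definition rc_minus :: "'a topology \<Rightarrow> 'a set \<Rightarrow> 'a set" where
  "rc_minus T X = T closure_of (topspace T - X)"

definition rc_le :: "'a topology \<Rightarrow> 'a set \<Rightarrow> 'a set \<Rightarrow> bool" where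
  "rc_le T X Y \<longleftrightarrow> rc_times T X Y = X"

definition notC :: "'a topology \<Rightarrow> 'a set \<Rightarrow> 'a set \<Rightarrow> bool" where
  "notC T X Y \<longleftrightarrow> connectedin T X \<and> connectedin T Y \<and> \<not> connectedin T (rc_plus T X Y)"

text \<open>The formula phi^c_infinity, evaluated in an interpretation: variables r_i, r'_i (rp i),
  s_i (sv i), t_i (tv i) for i = 0..3, and s, t.\<close>
definition phi_c_inf :: "'a topology \<Rightarrow> (nat \<Rightarrow> 'a set) \<Rightarrow> (nat \<Rightarrow> 'a set) \<Rightarrow> (nat \<Rightarrow> 'a set)
    \<Rightarrow> (nat \<Rightarrow> 'a set) \<Rightarrow> 'a set \<Rightarrow> 'a set \<Rightarrow> bool" where
  "phi_c_inf T r rp sv tv s t \<longleftrightarrow>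
     \<comment> \<open>(1)\<close>
     rc_plus T (rc_plus T (rc_plus T (r 0) (r 1)) (r 2)) (r 3) = topspace T \<and>
     (\<forall>i j. i < j \<and> j \<le> 3 \<longrightarrow> rc_times T (r i) (r j) = {}) \<and>
     (\<forall>i\<le>3. r i \<noteq> {}) \<and>
     \<comment> \<open>(2)\<close>
     (\<forall>i\<in>{0,1}.
        notC T (rc_plus T (rc_times T (r i) (rc_minus T (rp i))) t) (rc_plus T (rp (i+2)) s) \<and>
        notC T (rc_plus T (rp i) s) (rc_plus T (rc_times T (r (i+2)) (rc_minus T (rp (i+2)))) t) \<and>
        notC T (rc_plus T (rp i) (sv i)) (rc_plus T (rp (i+2)) (sv (i+2))) \<and>
        notC T (rc_plus T (rc_times T (r i) (rc_minus T (rp i))) (tv i))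
               (rc_plus T (rc_times T (r (i+2)) (rc_minus T (rp (i+2)))) (tv (i+2)))) \<and>
     \<comment> \<open>(3)\<close>
     (\<forall>i\<le>3. rp i \<noteq> {} \<and> rc_le T (rp i) (r i)) \<and> t \<noteq> {} \<and>
     \<comment> \<open>(4)\<close>
     (\<forall>i\<le>3. connectedin T (rc_plus T (rc_plus T (rp i) (r ((i+1) mod 4))) t)) \<and>
     \<comment> \<open>(5)\<close>
     notC T (rc_plus T (rc_plus T (rc_plus T (rp 0) (rp 1)) (rp 2)) (rp 3)) t \<and>
     \<comment> \<open>(6)\<close>
     (\<forall>i\<le>3. notC T (rc_plus T (rp i) s)
                      (rc_plus T (rc_times T (r ((i+1) mod 4)) (rc_minus T (rp ((i+1) mod 4)))) t))"

definition rc_interp :: "'a topology \<Rightarrow> (nat \<Rightarrow> 'a set) \<Rightarrow> (nat \<Rightarrow> 'a set) \<Rightarrow> (nat \<Rightarrow> 'a set)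
    \<Rightarrow> (nat \<Rightarrow> 'a set) \<Rightarrow> 'a set \<Rightarrow> 'a set \<Rightarrow> bool" where
  "rc_interp T r rp sv tv s t \<longleftrightarrow>
     (\<forall>i\<le>3. regular_closed_in T (r i) \<and> regular_closed_in T (rp i) \<and>
             regular_closed_in T (sv i) \<and> regular_closed_in T (tv i)) \<and>
     regular_closed_in T s \<and> regular_closed_in T t"

definition unicoherent_space :: "'a topology \<Rightarrow> bool" where
  "unicoherent_space T \<longleftrightarrow> (\<forall>X1 X2. closedin T X1 \<and> closedin T X2 \<and> connectedin T X1 \<and> connectedin T X2
      \<and> topspace T = X1 \<union> X2 \<longrightarrow> connectedin T (X1 \<inter> X2))"

definition infinitely_many_components :: "'a topology \<Rightarrow> 'a set \<Rightarrow> bool" where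
  "infinitely_many_components T X \<longleftrightarrow> infinite (connected_components_of (subtopology T X))"

end

theory Submission
  imports Defs
begin

text \<open>
  The \<open>notC\<close> conditions say that certain regions are disjoint. Suppose every \<open>r i\<close> has finitely many
  components. By (4)--(6), a component \<open>X n\<close> of \<open>r (n mod 4)\<close> meeting \<open>rp (n mod 4)\<close> must touch a
  component \<open>X (n + 1)\<close> of \<open>r ((n + 1) mod 4)\<close> inside \<open>rp ((n + 1) mod 4)\<close>, which gives an infinite
  chain. For a component \<open>A\<close> of the regular complement of \<open>X (n + 1)\<close>, unicoherence makes
  \<open>A \<inter> X (n + 1)\<close> connected; it lies in the union of the disjoint closed sets \<open>r (n mod 4)\<close> and
  \<open>r ((n + 2) mod 4)\<close>, so \<open>A\<close> cannot contain both \<open>X n\<close> and \<open>X (n + 2)\<close>. Hence the components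
  containing \<open>X n\<close> of the complements of \<open>X (n + 1)\<close> increase with \<open>n\<close>, and the \<open>X n\<close> in one residue
  class modulo 4 are pairwise distinct.

  For satisfiability, use two coordinates of \<open>\<real>\<^sup>n\<close>, take for \<open>r i\<close> the union of the square rings with
  index \<open>i\<close> modulo 4, and cut each ring by a vertical line into a right half, belonging to \<open>rp i\<close>, and
  a left half; the lines move slightly to the left from each ring to the next.
\<close>

section \<open>Infinitely many components\<close>

lemma connectedin_star:
  assumes "connectedin T H"
    and "\<And>F. F \<in> \<F> \<Longrightarrow> connectedin T F" "\<And>F. F \<in> \<F> \<Longrightarrow> F \<inter> H \<noteq> {}"
  shows "connectedin T (H \<union> \<Union>\<F>)"
proof (cases "H = {}")
  case True
  with assms(3) have "\<F> = {}" by auto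
  with assms(1) show ?thesis by simp
next
  case False
  \<comment> \<open>Every member of this family contains \<open>H\<close>, so the family may be
    infinite.\<close>
  have "connectedin T (\<Union>(insert H ((\<union>) H ` \<F>)))"
  proof (rule connectedin_Union)
    show "\<Inter> (insert H ((\<union>) H ` \<F>)) \<noteq> {}" using False by auto
  next
    fix S assume "S \<in> insert H ((\<union>) H ` \<F>)"
    then show "connectedin T S"
      using assms connectedin_Un[of T H] by (auto simp: Int_commute)
  qed
  moreover have "\<Union>(insert H ((\<union>) H ` \<F>)) = H \<union> \<Union>\<F>" by auto
  ultimately show ?thesis by simp
qed

lemma connectedin_closed_cases:
  assumes "connectedin T S" "closedin T E" "closedin T F" "S \<subseteq> E \<union> F" "E \<inter> F \<inter> S = {}"
  shows "E \<inter> S = {} \<or> F \<inter> S = {}"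
  using assms unfolding connectedin_closedin by blast

lemma component_of_closed:
  assumes "closedin T Y" "C \<in> connected_components_of (subtopology T Y)"
  shows "closedin T C" "connectedin T C" "C \<noteq> {}" "C \<subseteq> Y"
proof -
  show "closedin T C"
    using assms closedin_connected_components_of closedin_trans_full by blast
  show "connectedin T C" "C \<subseteq> Y"
    using connectedin_connected_components_of[OF assms(2)] by (auto simp: connectedin_subtopology)
  show "C \<noteq> {}"
    by (rule nonempty_connected_components_of[OF assms(2)])
qed

lemma component_maximal:
  assumes "C \<in> connected_components_of (subtopology T Y)" "connectedin T S" "S \<subseteq> Y" "S \<inter> C \<noteq> {}"
  shows "S \<subseteq> C"
  using connected_components_of_maximal[OF assms(1)] assms(2-)
  by (auto simp: connectedin_subtopology disjnt_def)

lemma component_containing: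
  assumes "connectedin T S" "S \<subseteq> Y" "S \<noteq> {}"
  obtains C where "C \<in> connected_components_of (subtopology T Y)" "S \<subseteq> C"
proof -
  have "connectedin (subtopology T Y) S"
    using assms by (auto simp: connectedin_subtopology)
  moreover have "subtopology T Y \<noteq> trivial_topology"
    using calculation assms(3) connectedin_subset_topspace by fastforce
  ultimately show ?thesis
    using exists_connected_component_of_superset that by blast
qed

text \<open>Unicoherence is applied to \<open>A\<close> and the closure of \<open>X\<close> together with the other components.\<close>
lemma connectedin_complement_component_Int:
  assumes lc: "locally_connected_space T" and uni: "unicoherent_space T" and con: "connected_space T"
    and X: "closedin T X" "connectedin T X" "X \<noteq> {}"
    and A: "A \<in> connected_components_of (subtopology T (T closure_of (topspace T - X)))"
  shows "connectedin T (A \<inter> X)"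
proof -
  define Y where "Y = T closure_of (topspace T - X)"
  define CC where "CC = connected_components_of (subtopology T Y)"
  define B where "B = X \<union> \<Union>(CC - {A})"
  have Ycl: "closedin T Y" by (simp add: Y_def)
  have Ysub: "topspace T - X \<subseteq> Y" unfolding Y_def by (rule closure_of_subset) auto
  have ACC: "A \<in> CC" using A by (simp add: CC_def Y_def)
  note comp = component_of_closed[OF Ycl]
  have UCC: "\<Union>CC = Y"
    unfolding CC_def Union_connected_components_of using closedin_subset[OF Ycl] by auto
  \<comment> \<open>A point of \<open>K\<close> off \<open>X\<close> has a connected open
    neighbourhood missing \<open>X\<close>; it lies in \<open>Y\<close>, hence in the single
    component \<open>K\<close>.\<close>
  have nbhd: "\<exists>U. openin T U \<and> x \<in> U \<and> U \<subseteq> K \<and> U \<inter> X = {}"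
    if "x \<in> K" "x \<notin> X" "K \<in> CC" for x K
  proof -
    have K: "K \<in> connected_components_of (subtopology T Y)" using that by (simp add: CC_def)
    have "x \<in> topspace T - X"
      using that comp[OF K] closedin_subset[OF Ycl] by auto
    moreover have "openin T (topspace T - X)" using X by auto
    ultimately obtain U where U: "openin T U" "connectedin T U" "x \<in> U" "U \<subseteq> topspace T - X"
      using lc unfolding locally_connected_space by blast
    have "U \<subseteq> K"
      by (rule component_maximal[OF K U(2)]) (use U Ysub that in auto)
    with U show ?thesis by blast
  qed
  \<comment> \<open>Otherwise \<open>K\<close> is clopen, hence the whole space, leaving no room for
    the nonempty \<open>X\<close>.\<close>
  have meets: "K \<inter> X \<noteq> {}" if K: "K \<in> CC" for K
  proof
    assume "K \<inter> X = {}"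
    then have "\<exists>U. openin T U \<and> x \<in> U \<and> U \<subseteq> K" if "x \<in> K" for x
      using nbhd[OF that _ K] that by blast
    then have "openin T K" by (meson openin_subopen)
    moreover have "closedin T K" "K \<noteq> {}" using comp K by (auto simp: CC_def)
    ultimately have "K = topspace T" using con connected_space_clopen_in by blast
    then show False using \<open>K \<inter> X = {}\<close> X closedin_subset by fastforce
  qed
  have Bcon: "connectedin T B"
    unfolding B_def
    by (rule connectedin_star) (use X comp meets in \<open>auto simp: CC_def\<close>)
  have Bsub: "B \<subseteq> topspace T" by (rule connectedin_subset_topspace[OF Bcon])
  have "topspace T = A \<union> T closure_of B"
  proof -
    have "topspace T \<subseteq> A \<union> B" using Ysub UCC by (auto simp: B_def)
    moreover have "B \<subseteq> T closure_of B" by (rule closure_of_subset[OF Bsub])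
    moreover have "A \<subseteq> topspace T" using comp(1) ACC closedin_subset by (auto simp: CC_def)
    moreover have "T closure_of B \<subseteq> topspace T" by (rule closure_of_subset_topspace)
    ultimately show ?thesis by blast
  qed
  then have "connectedin T (A \<inter> T closure_of B)"
    using uni ACC comp connectedin_closure_of[OF Bcon] unfolding unicoherent_space_def CC_def
    by (metis closedin_closure_of)
  \<comment> \<open>With infinitely many components \<open>B\<close> may fail to be closed, but its
    closure adds nothing inside \<open>A\<close>: a point of \<open>A\<close> off \<open>X\<close>
    has a neighbourhood in \<open>A\<close> that misses \<open>X\<close> and all other
    components.\<close>
  moreover have "A \<inter> T closure_of B = A \<inter> X"
  proof
    have "X \<subseteq> T closure_of B"
      using closure_of_subset[OF Bsub] by (auto simp: B_def)
    then show "A \<inter> X \<subseteq> A \<inter> T closure_of B" by blast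
    show "A \<inter> T closure_of B \<subseteq> A \<inter> X"
    proof
      fix x assume x: "x \<in> A \<inter> T closure_of B"
      have "x \<in> X"
      proof (rule ccontr)
        assume "x \<notin> X"
        then obtain U where U: "openin T U" "x \<in> U" "U \<subseteq> A" "U \<inter> X = {}"
          using nbhd[of x A] x ACC by blast
        have "A \<inter> K = {}" if "K \<in> CC - {A}" for K
          using that ACC connected_components_of_overlap[of A _ K] unfolding CC_def by blast
        then have "U \<inter> B = {}" using U unfolding B_def by blast
        with U(1) have "U \<inter> T closure_of B = {}" by (simp add: openin_Int_closure_of_eq_empty)
        then show False using x U(2) by blast
      qed
      then show "x \<in> A \<inter> X" using x by blast
    qed
  qed
  ultimately show ?thesis by simp
qed

section \<open>The infinite chain of components\<close>

text \<open>The sequences have period 4 but run over all naturals, so the chain is indexed without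
  reduction. \<open>opp\<close> encodes (2), \<open>con\<close> encodes (4), \<open>next_P\<close>
  and \<open>Pt\<close> encode (6); \<open>dense1\<close> and \<open>dense2\<close> are the set form
  of the vanishing products of neighbouring regions.\<close>

lemma infinite_chain_of_components:
  fixes R P :: "nat \<Rightarrow> 'a set"
  assumes lc: "locally_connected_space T" and uni: "unicoherent_space T"
    and period: "\<And>n. R (n + 4) = R n"
    and clR: "\<And>n. closedin T (R n)" and clP: "\<And>n. closedin T (P n)" and clt: "closedin T t"
    and PR: "\<And>n. P n \<subseteq> R n" and P0: "P 0 \<noteq> {}" and t: "t \<noteq> {}"
    and cover: "topspace T = R 0 \<union> R 1 \<union> R 2 \<union> R 3"
    and opp: "\<And>n. R n \<inter> R (n + 2) = {}"
    and next_P: "\<And>n. P n \<inter> R (n + 1) \<subseteq> P (n + 1)"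
    and Pt: "\<And>n. P n \<inter> t = {}"
    and con: "\<And>n. connectedin T (P n \<union> R (n + 1) \<union> t)"
    and dense1: "\<And>n. R n \<subseteq> T closure_of (topspace T - R (n + 1))"
    and dense2: "\<And>n. R (n + 1) \<subseteq> T closure_of (topspace T - R n)"
    and fin: "\<And>n. finite (connected_components_of (subtopology T (R n)))"
  shows False
proof -
  have all4: "topspace T = R n \<union> R (n + 1) \<union> R (n + 2) \<union> R (n + 3)" for n
  proof (induction n)
    case 0 show ?case using cover by (simp add: numeral_eq_Suc)
  next
    case (Suc n)
    have "R (Suc n + 3) = R n" using period[of n] by (simp add: numeral_eq_Suc)
    then show ?case using Suc by (auto simp: numeral_eq_Suc)
  qed
  \<comment> \<open>The four connected sets of \<open>con\<close> share \<open>t\<close> and cover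
    the space.\<close>
  have conT: "connected_space T"
  proof -
    have "topspace T \<subseteq> \<Union>((\<lambda>n. P n \<union> R (n + 1) \<union> t) ` {0,1,2,3})"
    proof
      fix x assume "x \<in> topspace T"
      then have "x \<in> R (0 + 1) \<or> x \<in> R (1 + 1) \<or> x \<in> R (2 + 1) \<or> x \<in> R (3 + 1)"
        using cover period[of 0] by (auto simp: numeral_eq_Suc)
      then show "x \<in> \<Union>((\<lambda>n. P n \<union> R (n + 1) \<union> t) ` {0,1,2,3})" by blast
    qed
    moreover have "\<Union>((\<lambda>n. P n \<union> R (n + 1) \<union> t) ` {0,1,2,3}) \<subseteq> topspace T"
      using con[THEN connectedin_subset_topspace] by blast
    ultimately have "topspace T = \<Union>((\<lambda>n. P n \<union> R (n + 1) \<union> t) ` {0,1,2,3})"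
      by (rule subset_antisym)
    moreover have "\<Inter>((\<lambda>n. P n \<union> R (n + 1) \<union> t) ` {0,1,2,3}) \<noteq> {}" using t by blast
    then have "connectedin T (\<Union>((\<lambda>n. P n \<union> R (n + 1) \<union> t) ` {0,1,2,3}))"
      using con by (intro connectedin_Union) blast+
    ultimately show ?thesis using connectedin_topspace by metis
  qed
  define CC where "CC n = connected_components_of (subtopology T (R n))" for n
  have UCC: "\<Union>(CC n) = R n" for n
    unfolding CC_def Union_connected_components_of using closedin_subset[OF clR] by auto
  have comp: "closedin T C" "connectedin T C" "C \<noteq> {}" "C \<subseteq> R n" if "C \<in> CC n" for C n
    using component_of_closed[OF clR] that by (auto simp: CC_def)
  have step: "\<exists>X'. (X' \<in> CC (Suc n) \<and> X' \<inter> P (Suc n) \<noteq> {}) \<and> X \<inter> X' \<noteq> {}"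
    if X: "X \<in> CC n \<and> X \<inter> P n \<noteq> {}" for X n
  proof -
    \<comment> \<open>Finiteness makes the union of the other components closed. If
      \<open>X \<inter> P n\<close> missed \<open>R (n + 1)\<close>, then it and \<open>E\<close>
      would separate the connected set of \<open>con\<close>.\<close>
    have "X \<inter> P n \<inter> R (n + 1) \<noteq> {}"
    proof
      assume emp: "X \<inter> P n \<inter> R (n + 1) = {}"
      define E where "E = (\<Union>(CC n - {X}) \<inter> P n) \<union> R (n + 1) \<union> t"
      have "closedin T (\<Union>(CC n - {X}))"
        using fin[of n] comp by (intro closedin_Union) (auto simp: CC_def)
      then have "closedin T E"
        unfolding E_def by (intro closedin_Un closedin_Int clP clR clt)
      moreover have "closedin T (X \<inter> P n)" using X comp clP by blast
      moreover have "X \<inter> K = {}" if "K \<in> CC n - {X}" for K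
        using that X connected_components_of_overlap[of X _ K] unfolding CC_def by blast
      then have "X \<inter> P n \<inter> E = {}"
        unfolding E_def using emp Pt[of n] by blast
      moreover have "P n \<union> R (n + 1) \<union> t \<subseteq> (X \<inter> P n) \<union> E"
        unfolding E_def using PR[of n] UCC[of n] by blast
      ultimately have "(X \<inter> P n) \<inter> (P n \<union> R (n + 1) \<union> t) = {} \<or> E \<inter> (P n \<union> R (n + 1) \<union> t) = {}"
        by (intro connectedin_closed_cases[OF con]) auto
      then show False using X t unfolding E_def by blast
    qed
    then obtain q where q: "q \<in> X" "q \<in> P n" "q \<in> R (n + 1)" by blast
    then obtain X' where "X' \<in> CC (n + 1)" "q \<in> X'" using UCC by blast
    moreover have "q \<in> P (n + 1)" using q next_P by blast
    ultimately show ?thesis using q by auto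
  qed
  obtain X where X: "\<And>n. X n \<in> CC n" "\<And>n. X n \<inter> X (Suc n) \<noteq> {}"
  proof -
    have "\<exists>X. X \<in> CC 0 \<and> X \<inter> P 0 \<noteq> {}"
      using P0 PR[of 0] UCC[of 0] by blast
    from dependent_nat_choice[of "\<lambda>n X. X \<in> CC n \<and> X \<inter> P n \<noteq> {}" "\<lambda>n X X'. X \<inter> X' \<noteq> {}",
        OF this step] that show thesis by blast
  qed
  note XR = comp[OF X(1)]
  define Y where "Y n = T closure_of (topspace T - X n)" for n
  have Ycl: "closedin T (Y n)" for n by (simp add: Y_def)
  have notX: "topspace T - X n \<subseteq> Y n" for n
    unfolding Y_def by (rule closure_of_subset) auto
  \<comment> \<open>By density, each of two consecutive chain members lies in the closed complement
    \<open>Y\<close> of the other.\<close>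
  have XY1: "X n \<subseteq> Y (Suc n)" for n
  proof -
    have "T closure_of (topspace T - R (n + 1)) \<subseteq> Y (Suc n)"
      unfolding Y_def using XR(4)[of "Suc n"] by (intro closure_of_mono) auto
    then show ?thesis using dense1[of n] XR(4)[of n] by blast
  qed
  have XY2: "X (Suc n) \<subseteq> Y n" for n
  proof -
    have "T closure_of (topspace T - R n) \<subseteq> Y n"
      unfolding Y_def using XR(4)[of n] by (intro closure_of_mono) auto
    then show ?thesis using dense2[of n] XR(4)[of "Suc n"] by auto
  qed
  \<comment> \<open>A point of \<open>X (n + 1)\<close> avoids the opposite region
    \<open>R (n + 3)\<close>. If it also avoids \<open>R n\<close> and \<open>R (n + 2)\<close>,
    then a connected neighbourhood of it stays in \<open>R (n + 1)\<close>, hence in the component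
    \<open>X (n + 1)\<close>, so the point is not in \<open>Y (n + 1)\<close>.\<close>
  have front: "X (Suc n) \<inter> Y (Suc n) \<subseteq> R n \<union> R (n + 2)" for n
  proof
    fix x assume x: "x \<in> X (Suc n) \<inter> Y (Suc n)"
    show "x \<in> R n \<union> R (n + 2)"
    proof (rule ccontr)
      assume nx: "x \<notin> R n \<union> R (n + 2)"
      define O' where "O' = topspace T - (R n \<union> R (n + 2) \<union> R (n + 3))"
      have "x \<in> R (n + 1)" using x XR(4)[of "Suc n"] by auto
      moreover have "R (n + 1) \<inter> R (n + 3) = {}" using opp[of "n+1"] by (simp add: numeral_eq_Suc)
      ultimately have "x \<in> O'" using nx closedin_subset[OF clR] by (auto simp: O'_def)
      moreover have "openin T O'"
        unfolding O'_def by (intro openin_diff closedin_Un clR openin_topspace)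
      ultimately obtain U where U: "openin T U" "connectedin T U" "x \<in> U" "U \<subseteq> O'"
        using lc unfolding locally_connected_space by blast
      have "U \<subseteq> R (Suc n)" using U all4[of n] by (auto simp: O'_def)
      then have "U \<subseteq> X (Suc n)"
        using component_maximal[OF _ U(2)] X(1)[of "Suc n"] U x unfolding CC_def by blast
      then have "U \<inter> (topspace T - X (Suc n)) = {}" by blast
      with U(1) have "U \<inter> Y (Suc n) = {}" unfolding Y_def by (simp add: openin_Int_closure_of_eq_empty)
      then show False using x U(3) by blast
    qed
  qed
  have "\<exists>S. S \<in> connected_components_of (subtopology T (Y (Suc n))) \<and> X n \<subseteq> S" for n
    using component_containing[OF XR(2) XY1 XR(3)] by blast
  then obtain S where S: "\<And>n. S n \<in> connected_components_of (subtopology T (Y (Suc n)))"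
    "\<And>n. X n \<subseteq> S n" by metis
  note SY = component_of_closed[OF Ycl S(1)]
  \<comment> \<open>If \<open>S n\<close> met \<open>X (n + 2)\<close>, it would contain it. The
    connected set \<open>S n \<inter> X (n + 1)\<close> would then meet both of the disjoint closed
    sets \<open>R n\<close> and \<open>R (n + 2)\<close> that cover it.\<close>
  have sep: "S n \<inter> X (n + 2) = {}" for n
  proof (rule ccontr)
    assume "S n \<inter> X (n + 2) \<noteq> {}"
    then have sub: "X (n + 2) \<subseteq> S n"
      using component_maximal[OF S(1) XR(2), of "n + 2" n] XY2[of "Suc n"] by auto
    have "connectedin T (S n \<inter> X (Suc n))"
      using connectedin_complement_component_Int[OF lc uni conT XR(1-3)] S(1)[of n]
      unfolding Y_def by blast
    moreover have "S n \<inter> X (Suc n) \<subseteq> R n \<union> R (n + 2)"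
      using front[of n] SY(4)[of n] by blast
    ultimately have "R n \<inter> (S n \<inter> X (Suc n)) = {} \<or> R (n + 2) \<inter> (S n \<inter> X (Suc n)) = {}"
      using opp[of n] by (intro connectedin_closed_cases[OF _ clR clR]) auto
    moreover have "R n \<inter> (S n \<inter> X (Suc n)) \<noteq> {}"
      using X(2)[of n] S(2)[of n] XR(4)[of n] by blast
    moreover have "R (n + 2) \<inter> (S n \<inter> X (Suc n)) \<noteq> {}"
      using X(2)[of "Suc n"] sub XR(4)[of "Suc (Suc n)"] by auto
    ultimately show False by blast
  qed
  \<comment> \<open>Since \<open>S n\<close> avoids \<open>X (n + 2)\<close>, the connected set
    \<open>S n \<union> X (n + 1)\<close> lies in \<open>Y (n + 2)\<close>, hence in its component
    \<open>S (n + 1)\<close>.\<close>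
  have mono: "S n \<subseteq> S (Suc n)" for n
  proof -
    have "S n \<union> X (Suc n) \<subseteq> S (Suc n)"
    proof (rule component_maximal[OF S(1)])
      show "connectedin T (S n \<union> X (Suc n))"
        using SY(2) XR(2) S(2)[of n] X(2)[of n] by (intro connectedin_Un) auto
      have "S n \<subseteq> topspace T" using SY(1) closedin_subset by blast
      then show "S n \<union> X (Suc n) \<subseteq> Y (Suc (Suc n))"
        using XY1[of "Suc n"] sep[of n] notX[of "Suc (Suc n)"] by auto
      show "(S n \<union> X (Suc n)) \<inter> S (Suc n) \<noteq> {}"
        using S(2)[of "Suc n"] XR(3)[of "Suc n"] by blast
    qed
    then show ?thesis by blast
  qed
  have disj: "X m \<inter> X (n + 2) = {}" if "m \<le> n" for m n
    using lift_Suc_mono_le[of S, OF mono that] S(2)[of m] sep[of n] by blast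
  \<comment> \<open>Multiples of 4 stay in residue class 0, and gaps of at least 4 leave room for
    the shift by 2 in \<open>disj\<close>.\<close>
  have "inj (\<lambda>k. X (4 * k))"
  proof (rule linorder_injI)
    fix j k :: nat assume "j < k"
    then have "4 * j \<le> 4 * k - 2" "4 * k - 2 + 2 = 4 * k" by auto
    then show "X (4 * j) \<noteq> X (4 * k)" using disj[of "4*j" "4*k-2"] XR(3)[of "4*k"] by auto
  qed
  moreover have "range (\<lambda>k. X (4 * k)) \<subseteq> CC 0"
  proof -
    have "R (4 * k) = R 0" for k
    proof (induction k)
      case (Suc k)
      then show ?case using period[of "4 * k"] by (simp add: add.commute)
    qed simp
    then have "CC (4 * k) = CC 0" for k by (simp add: CC_def)
    then show ?thesis using X(1) by blast
  qed
  ultimately have "infinite (CC 0)"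
    using range_inj_infinite finite_subset by blast
  then show False using fin[of 0] by (simp add: CC_def)
qed

section \<open>Set-level consequences of the formula\<close>

text \<open>Connected sets with a common point have a connected union.\<close>

lemma notC_disjoint:
  assumes "notC T X Y"
  shows "X \<inter> Y = {}"
  using assms connectedin_Un unfolding notC_def rc_plus_def by blast

lemma regular_closed_in_closedin:
  "regular_closed_in T X \<Longrightarrow> closedin T X"
  unfolding regular_closed_in_def by (metis closedin_closure_of)

text \<open>The open set \<open>T interior_of r - p\<close> lies in the product, and taking closures
  recovers all of \<open>r\<close> because \<open>p\<close> and the product are closed. Thus
  disjointness of the two pieces of a region from a set gives disjointness of the region.\<close>

lemma regular_closed_subset_Un_rc_minus:
  assumes r: "regular_closed_in T r" and p: "regular_closed_in T p"
  shows "r \<subseteq> p \<union> rc_times T r (rc_minus T p)"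
proof -
  let ?a = "rc_times T r (rc_minus T p)"
  have clp: "closedin T p" by (rule regular_closed_in_closedin[OF p])
  have "T interior_of r - p \<subseteq> T interior_of (r \<inter> T closure_of (topspace T - p))"
  proof (rule interior_of_maximal)
    show "openin T (T interior_of r - p)" by (rule openin_diff[OF openin_interior_of clp])
    have "T interior_of r - p \<subseteq> topspace T - p" using interior_of_subset_topspace by fastforce
    also have "\<dots> \<subseteq> T closure_of (topspace T - p)" by (rule closure_of_subset) auto
    finally show "T interior_of r - p \<subseteq> r \<inter> T closure_of (topspace T - p)"
      using interior_of_subset[of T r] by blast
  qed
  also have "\<dots> \<subseteq> ?a"
    unfolding rc_times_def rc_minus_def by (rule closure_of_subset) (rule interior_of_subset_topspace)
  finally have "T interior_of r \<subseteq> p \<union> ?a" by blast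
  moreover have "closedin T (p \<union> ?a)"
    using clp by (simp add: closedin_Un rc_times_def)
  ultimately have "T closure_of (T interior_of r) \<subseteq> p \<union> ?a" by (rule closure_of_minimal)
  with r show ?thesis by (simp add: regular_closed_in_def)
qed

text \<open>The interiors are disjoint, and an open set missing the interior of \<open>Y\<close>
  misses its closure \<open>Y\<close>. Hence the interior of \<open>X\<close>, whose closure is
  \<open>X\<close>, lies in the complement of \<open>Y\<close>.\<close>

lemma regular_closed_rc_times_empty:
  assumes X: "regular_closed_in T X" and Y: "regular_closed_in T Y" and "rc_times T X Y = {}"
  shows "X \<subseteq> T closure_of (topspace T - Y)"
proof -
  have "T interior_of (X \<inter> Y) = {}"
    using assms(3) closure_of_subset[OF interior_of_subset_topspace, of T "X \<inter> Y"]
    unfolding rc_times_def by blast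
  then have "T interior_of X \<inter> T interior_of Y = {}" by (simp add: interior_of_Int)
  then have "T interior_of X \<inter> T closure_of (T interior_of Y) = {}"
    by (simp add: openin_Int_closure_of_eq_empty)
  then have "T interior_of X \<inter> Y = {}" using Y unfolding regular_closed_in_def by metis
  then have "T interior_of X \<subseteq> topspace T - Y" using interior_of_subset_topspace[of T X] by blast
  then have "T closure_of (T interior_of X) \<subseteq> T closure_of (topspace T - Y)" by (rule closure_of_mono)
  with X show ?thesis by (simp add: regular_closed_in_def)
qed

text \<open>Extends the variables periodically and reads the hypotheses of the chain lemma off the
  formula. The variable found is always one of the \<open>r i\<close>.\<close>

lemma phi_c_inf_infinitely_many_components:
  assumes lc: "locally_connected_space T" and uni: "unicoherent_space T"
    and I: "rc_interp T r rp sv tv s t" and phi: "phi_c_inf T r rp sv tv s t"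
  shows "\<exists>i\<le>3. infinitely_many_components T (r i)"
proof (rule ccontr)
  assume "\<not> ?thesis"
  then have fin: "finite (connected_components_of (subtopology T (r i)))" if "i \<le> 3" for i
    using that by (auto simp: infinitely_many_components_def)
  define R where "R n = r (n mod 4)" for n :: nat
  define P where "P n = rp (n mod 4)" for n :: nat
  define A where "A n = rc_times T (R n) (rc_minus T (P n))" for n :: nat
  have m4: "n mod 4 \<le> 3" for n :: nat by (rule less_Suc_eq_le[THEN iffD1]) simp
  have rR: "regular_closed_in T (R n)" and rP: "regular_closed_in T (P n)" for n
    using I m4 by (auto simp: rc_interp_def R_def P_def)
  have rt: "regular_closed_in T t" using I by (simp add: rc_interp_def)
  have RPA: "R n \<subseteq> P n \<union> A n" for n
    unfolding A_def by (rule regular_closed_subset_Un_rc_minus[OF rR rP])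
  have PR: "P n \<subseteq> R n" for n
  proof -
    have "rc_times T (P n) (R n) = P n"
      using phi m4[of n] by (auto simp: phi_c_inf_def rc_le_def R_def P_def)
    moreover have "rc_times T (P n) (R n) \<subseteq> R n"
      unfolding rc_times_def
      using interior_of_subset[of T "P n \<inter> R n"] regular_closed_in_closedin[OF rR]
      by (intro closure_of_minimal) auto
    ultimately show ?thesis by simp
  qed
  \<comment> \<open>The four clauses of (2) separate each of the pieces \<open>P i\<close>,
    \<open>A i\<close> from both opposite pieces, and the pieces cover the regions.\<close>
  have "\<forall>i\<in>{0,1}. R i \<inter> R (i + 2) = {}"
  proof
    fix i :: nat assume i: "i \<in> {0,1}"
    then have "i mod 4 = i" "(i + 2) mod 4 = i + 2" by auto
    then have e: "R i = r i" "P i = rp i" "R (i + 2) = r (i + 2)" "P (i + 2) = rp (i + 2)"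
      by (simp_all only: R_def P_def)
    have "notC T (A i \<union> t) (P (i + 2) \<union> s)" "notC T (P i \<union> s) (A (i + 2) \<union> t)"
      "notC T (P i \<union> sv i) (P (i + 2) \<union> sv (i + 2))" "notC T (A i \<union> tv i) (A (i + 2) \<union> tv (i + 2))"
      using phi[unfolded phi_c_inf_def rc_plus_def, THEN conjunct2, THEN conjunct2, THEN conjunct2,
          THEN conjunct1, rule_format, OF i]
      unfolding e A_def by blast+
    then have "A i \<inter> P (i + 2) = {}" "P i \<inter> A (i + 2) = {}" "P i \<inter> P (i + 2) = {}" "A i \<inter> A (i + 2) = {}"
      by (auto dest!: notC_disjoint)
    then show "R i \<inter> R (i + 2) = {}" using RPA[of i] RPA[of "i + 2"] by blast
  qed
  then have "R 0 \<inter> R 2 = {}" "R 1 \<inter> R 3 = {}"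
    by (auto simp add: eval_nat_numeral)
  then have opp: "R n \<inter> R (n + 2) = {}" for n
  proof -
    have "n mod 4 = 0 \<and> (n + 2) mod 4 = 2 \<or> n mod 4 = 1 \<and> (n + 2) mod 4 = 3 \<or>
      n mod 4 = 2 \<and> (n + 2) mod 4 = 0 \<or> n mod 4 = 3 \<and> (n + 2) mod 4 = 1" by presburger
    with \<open>R 0 \<inter> R 2 = {}\<close> \<open>R 1 \<inter> R 3 = {}\<close> show ?thesis by (auto simp: R_def)
  qed
  have s1: "R (n + 1) = r ((n mod 4 + 1) mod 4)" "P (n + 1) = rp ((n mod 4 + 1) mod 4)" for n
    by (auto simp: R_def P_def mod_simps)
  have "notC T (rc_plus T (P n) s) (rc_plus T (A (n + 1)) t)" for n
    using phi m4[of n] unfolding phi_c_inf_def A_def s1 by (simp add: P_def)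
  \<comment> \<open>Condition (6) serves twice: it separates \<open>P n\<close> from
    \<open>A (n + 1)\<close> and from \<open>t\<close>.\<close>
  then have PA: "(P n \<union> s) \<inter> (A (n + 1) \<union> t) = {}" for n
    by (metis notC_disjoint rc_plus_def)
  have time: "rc_times T (R n) (R (n + 1)) = {}" "rc_times T (R (n + 1)) (R n) = {}" for n
  proof -
    have "n mod 4 = 0 \<and> (n + 1) mod 4 = 1 \<or> n mod 4 = 1 \<and> (n + 1) mod 4 = 2 \<or>
      n mod 4 = 2 \<and> (n + 1) mod 4 = 3 \<or> n mod 4 = 3 \<and> (n + 1) mod 4 = 0" by presburger
    moreover have "\<forall>i j. i < j \<and> j \<le> 3 \<longrightarrow> rc_times T (r i) (r j) = {}"
      using phi by (simp add: phi_c_inf_def)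
    moreover have "rc_times T X Y = rc_times T Y X" for X Y
      by (simp add: rc_times_def Int_commute)
    ultimately show "rc_times T (R n) (R (n + 1)) = {}" "rc_times T (R (n + 1)) (R n) = {}"
      by (auto simp: R_def)
  qed
  show False
  proof (rule infinite_chain_of_components[OF lc uni, of R P t])
    show "R (n + 4) = R n" for n by (simp add: R_def)
    show "closedin T (R n)" "closedin T (P n)" "closedin T t" for n
      using rR rP rt regular_closed_in_closedin by blast+
    show "P n \<subseteq> R n" for n by (rule PR)
    show "P 0 \<noteq> {}" "t \<noteq> {}" using phi by (auto simp: phi_c_inf_def P_def)
    show "topspace T = R 0 \<union> R 1 \<union> R 2 \<union> R 3"
      using phi by (auto simp: phi_c_inf_def rc_plus_def R_def)
    show "R n \<inter> R (n + 2) = {}" for n by (rule opp)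
    show "P n \<inter> R (n + 1) \<subseteq> P (n + 1)" for n using PA[of n] RPA[of "n + 1"] by blast
    show "P n \<inter> t = {}" for n using PA[of n] by blast
    show "connectedin T (P n \<union> R (n + 1) \<union> t)" for n
      using phi m4[of n] unfolding phi_c_inf_def rc_plus_def s1 by (simp add: P_def)
    show "R n \<subseteq> T closure_of (topspace T - R (n + 1))" for n
      by (rule regular_closed_rc_times_empty[OF rR rR time(1)])
    show "R (n + 1) \<subseteq> T closure_of (topspace T - R n)" for n
      by (rule regular_closed_rc_times_empty[OF rR rR time(2)])
    show "finite (connected_components_of (subtopology T (R n)))" for n
      unfolding R_def by (rule fin[OF m4])
  qed
qed

section \<open>Satisfiability in Euclidean space\<close>

lemma closure_interior_Un:
  fixes S U :: "'a::topological_space set"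
  assumes "closure (interior S) = S" "closure (interior U) = U"
  shows "closure (interior (S \<union> U)) = S \<union> U"
proof
  have "closed (S \<union> U)" using assms by (metis closed_Un closed_closure)
  then show "closure (interior (S \<union> U)) \<subseteq> S \<union> U"
    by (simp add: closure_minimal interior_subset)
  have "interior S \<union> interior U \<subseteq> interior (S \<union> U)" by (simp add: interior_mono)
  then show "S \<union> U \<subseteq> closure (interior (S \<union> U))"
    using assms by (metis closure_Un closure_mono)
qed

lemma closure_interior_convex:
  fixes S :: "'a::euclidean_space set"
  assumes "closed S" "convex S" "interior S \<noteq> {}"
  shows "closure (interior S) = S"
  using assms by (simp add: convex_closure_interior)

lemma notC_euclideanI:
  fixes X Y :: "'a::topological_space set"
  assumes "connected X" "connected Y" "closed X" "closed Y" "X \<inter> Y = {}" "X \<noteq> {}" "Y \<noteq> {}"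
  shows "notC euclidean X Y"
  using assms unfolding notC_def rc_plus_def by (auto simp: connected_closed_set[OF closed_Un])

text \<open>The interior of \<open>q\<close> misses \<open>p\<close>, so it survives in the product.
  Conversely, an open subset of \<open>closure (- p)\<close> misses the interior of
  \<open>p\<close>, hence also its closure \<open>p\<close>, and so lies in
  \<open>q\<close>.\<close>

lemma rc_times_rc_minus_euclidean:
  fixes p q :: "'a::topological_space set"
  assumes p: "closure (interior p) = p" and q: "closure (interior q) = q"
    and e: "interior (p \<inter> q) = {}"
  shows "rc_times euclidean (p \<union> q) (rc_minus euclidean p) = q"
proof -
  let ?O = "interior ((p \<union> q) \<inter> closure (- p))"
  have clp: "closed p" and clq: "closed q" using p q by (metis closed_closure)+
  have "interior p \<inter> interior q = {}" using e by (simp add: interior_Int)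
  then have "p \<inter> interior q = {}"
    using p open_Int_closure_eq_empty[OF open_interior, of q "interior p"] by (auto simp: Int_commute)
  then have "interior q \<subseteq> ?O"
    using interior_subset[of q] closure_subset[of "- p"] by (intro interior_maximal) auto
  then have 1: "q \<subseteq> closure ?O" using q closure_mono by metis
  have "interior p \<inter> closure (- p) = {}" by (simp add: closure_complement)
  then have "?O \<inter> interior p = {}" using interior_subset[of "(p \<union> q) \<inter> closure (- p)"] by blast
  then have "?O \<inter> p = {}"
    using p open_Int_closure_eq_empty[OF open_interior, of "(p \<union> q) \<inter> closure (- p)" "interior p"] by auto
  then have "?O \<subseteq> q" using interior_subset[of "(p \<union> q) \<inter> closure (- p)"] by blast
  then have 2: "closure ?O \<subseteq> q" using clq by (simp add: closure_minimal)
  show ?thesis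
    using 1 2 by (auto simp: rc_times_def rc_minus_def Compl_eq_Diff_UNIV)
qed

section \<open>Locally finite unions over residue classes\<close>

definition layers :: "(nat \<Rightarrow> 'a set) \<Rightarrow> nat \<Rightarrow> 'a set"
  where "layers F i = (\<Union>k\<in>{k. k mod 4 = i}. F k)"

lemma layers_Un: "layers (\<lambda>k. F k \<union> G k) i = layers F i \<union> layers G i"
  by (auto simp: layers_def)

lemma connected_layers_Un:
  fixes H :: "'a::topological_space set"
  assumes "connected H" "\<And>k. connected (F k)" "\<And>k. F k \<inter> H \<noteq> {}"
  shows "connected (layers F i \<union> H)"
proof -
  have "connectedin euclidean (H \<union> \<Union>(F ` {k. k mod 4 = i}))"
    by (rule connectedin_star) (use assms in auto)
  then show ?thesis by (simp add: layers_def Un_commute)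
qed

text \<open>The lower bound on \<open>f\<close> makes the family locally finite, so that the union of the layers is closed.\<close>
lemma closure_interior_layers:
  fixes F :: "nat \<Rightarrow> 'a::topological_space set" and f :: "'a \<Rightarrow> real"
  assumes F: "\<And>k. closure (interior (F k)) = F k" and f: "continuous_on UNIV f"
    and far: "\<And>k x. x \<in> F k \<Longrightarrow> real k \<le> f x"
  shows "closure (interior (layers F i)) = layers F i"
proof
  have cl: "closed (F k)" for k using F[of k] by (metis closed_closure)
  have "open (- layers F i)"
  proof (subst open_subopen, rule ballI)
    fix x assume x: "x \<in> - layers F i"
    obtain m :: nat where m: "f x < m" using reals_Archimedean2 by blast
    \<comment> \<open>Only the finitely many \<open>F k\<close> with \<open>k < m\<close> can meet
      \<open>{y. f y < m}\<close>, so finitely many closed sets have to be avoided.\<close>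
    define U where "U = {y. f y < m} \<inter> (\<Inter>k\<in>{k. k < m \<and> k mod 4 = i}. - F k)"
    have "open {y. f y < m}" using f by (intro open_Collect_less) auto
    then have "open U" unfolding U_def using cl by (intro open_Int open_INT) auto
    moreover have "x \<in> U" using x m by (auto simp: U_def layers_def)
    moreover have "U \<subseteq> - layers F i"
    proof
      fix y assume y: "y \<in> U"
      have "y \<notin> F k" if "k mod 4 = i" for k
      proof (cases "k < m")
        case True then show ?thesis using y that by (auto simp: U_def)
      next
        case False
        then show ?thesis using y far[of y k] by (force simp: U_def)
      qed
      then show "y \<in> - layers F i" by (auto simp: layers_def)
    qed
    ultimately show "\<exists>U. open U \<and> x \<in> U \<and> U \<subseteq> - layers F i" by blast
  qed
  then have "closed (layers F i)" by (simp add: closed_def)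
  then show "closure (interior (layers F i)) \<subseteq> layers F i"
    by (simp add: closure_minimal interior_subset)
  have "F k \<subseteq> closure (interior (layers F i))" if "k mod 4 = i" for k
  proof -
    have "F k \<subseteq> layers F i" using that by (auto simp: layers_def)
    then show ?thesis using F[of k] by (metis closure_mono interior_mono)
  qed
  then show "layers F i \<subseteq> closure (interior (layers F i))" by (auto simp: layers_def)
qed

text \<open>Strict decrease keeps the right part of ring \<open>k\<close> away from the left part of ring \<open>k + 1\<close>
  along their common boundary, while consecutive right parts still touch.\<close>
definition drop_height :: "nat \<Rightarrow> real"
  where "drop_height k = 1 / (real k + 1) - 1"

text \<open>The lower bound keeps right halves off the half-space \<open>x $ a \<le> - 1\<close>,
  the upper bound keeps left halves off \<open>1 \<le> x $ a\<close>.\<close>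

lemma drop_height_bounds: "- 1 < drop_height k" "drop_height k \<le> 0"
  by (auto simp: drop_height_def field_simps)

lemma drop_height_0: "drop_height 0 = 0"
  by (simp add: drop_height_def)

lemma drop_height_Suc: "drop_height (Suc k) < drop_height k"
  by (simp add: drop_height_def field_simps)

text \<open>Rationality puts all cutting lines into the null set \<open>grid\<close>.\<close>

lemma drop_height_Rats: "drop_height k \<in> \<rat>"
  by (auto simp: drop_height_def)

section \<open>Square rings over a coordinate plane\<close>

locale two_coordinates =
  fixes a b :: "'n::finite"
  assumes ab: "a \<noteq> b"
begin

text \<open>All sets below are cylinders over figures in the plane of \<open>a\<close> and
  \<open>b\<close>, so the remaining coordinates are free; here they are set to
  \<open>z\<close>.\<close>

definition point :: "real \<Rightarrow> real \<Rightarrow> real^'n"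
  where "point y z = (\<chi> i. if i = a then y else z)"

lemma point_nth [simp]: "point y z $ a = y" "point y z $ b = z"
  using ab by (auto simp: point_def)

definition slab :: "real \<Rightarrow> real \<Rightarrow> real \<Rightarrow> real \<Rightarrow> (real^'n) set"
  where "slab y1 y2 z1 z2 = {x. y1 \<le> x $ a \<and> x $ a \<le> y2 \<and> z1 \<le> x $ b \<and> x $ b \<le> z2}"

lemma mem_slab: "x \<in> slab y1 y2 z1 z2 \<longleftrightarrow> y1 \<le> x $ a \<and> x $ a \<le> y2 \<and> z1 \<le> x $ b \<and> x $ b \<le> z2"
  by (simp add: slab_def)

lemma halfspaces:
  fixes c :: real and i :: 'n
  shows "closed {x::real^'n. c \<le> x $ i}" "convex {x::real^'n. c \<le> x $ i}" "open {x::real^'n. c < x $ i}"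
    "closed {x::real^'n. x $ i \<le> c}" "convex {x::real^'n. x $ i \<le> c}" "open {x::real^'n. x $ i < c}"
proof -
  show "closed {x::real^'n. c \<le> x $ i}" "closed {x::real^'n. x $ i \<le> c}"
    by (intro closed_Collect_le continuous_intros)+
  show "open {x::real^'n. c < x $ i}" "open {x::real^'n. x $ i < c}"
    by (intro open_Collect_less continuous_intros)+
  show "convex {x::real^'n. c \<le> x $ i}" "convex {x::real^'n. x $ i \<le> c}"
    using convex_halfspace_ge[of c "axis i 1 :: real^'n"] convex_halfspace_le[of "axis i 1 :: real^'n" c]
    by (simp_all add: inner_axis' )
qed

lemma slab_eq: "slab y1 y2 z1 z2 = {x. y1 \<le> x $ a} \<inter> {x. x $ a \<le> y2} \<inter> {x. z1 \<le> x $ b} \<inter> {x. x $ b \<le> z2}"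
  by (auto simp: slab_def)

lemma convex_slab: "convex (slab y1 y2 z1 z2)"
  unfolding slab_eq by (intro convex_Int halfspaces)

lemma closure_interior_slab:
  assumes "y1 < y2" "z1 < z2"
  shows "closure (interior (slab y1 y2 z1 z2)) = slab y1 y2 z1 z2"
proof (rule closure_interior_convex[OF _ convex_slab])
  show "closed (slab y1 y2 z1 z2)"
    unfolding slab_eq by (intro closed_Int halfspaces)
  let ?U = "{x. y1 < x $ a} \<inter> {x. x $ a < y2} \<inter> {x. z1 < x $ b} \<inter> {x. x $ b < z2}"
  have "?U \<subseteq> interior (slab y1 y2 z1 z2)"
    by (intro interior_maximal open_Int halfspaces) (auto simp: slab_def)
  moreover have "point ((y1 + y2) / 2) ((z1 + z2) / 2) \<in> ?U" using assms by simp
  ultimately show "interior (slab y1 y2 z1 z2) \<noteq> {}" by blast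
qed

definition radius :: "real^'n \<Rightarrow> real"
  where "radius x = max \<bar>x $ a\<bar> \<bar>x $ b\<bar>"

text \<open>Shells of the maximum norm in two coordinates; \<open>ring 0\<close> is over a full
  square and has no hole.\<close>

definition ring :: "nat \<Rightarrow> (real^'n) set"
  where "ring k = {x. real k \<le> radius x \<and> radius x \<le> real k + 1}"

definition ringR :: "nat \<Rightarrow> (real^'n) set"
  where "ringR k = {x \<in> ring k. drop_height k \<le> x $ a}"

definition ringL :: "nat \<Rightarrow> (real^'n) set"
  where "ringL k = {x \<in> ring k. x $ a \<le> drop_height k}"

definition top_side :: "nat \<Rightarrow> (real^'n) set"
  where "top_side k = slab (- real k - 1) (real k + 1) (real k) (real k + 1)"

definition bot_side :: "nat \<Rightarrow> (real^'n) set"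
  where "bot_side k = slab (- real k - 1) (real k + 1) (- real k - 1) (- real k)"

lemma ring_subset: "ringR k \<subseteq> ring k" "ringL k \<subseteq> ring k" "top_side k \<subseteq> ring k" "bot_side k \<subseteq> ring k"
  by (auto simp: ringR_def ringL_def ring_def top_side_def bot_side_def mem_slab radius_def)

lemma ring_split: "ring k = ringR k \<union> ringL k"
  by (auto simp: ringR_def ringL_def)

text \<open>For \<open>k \<ge> 1\<close> the cut crosses the hole of the ring, while
  \<open>ring 0\<close> is cut at 0. In both cases a half ring has the same shape of three
  slabs.\<close>

lemma height_cases: "real k = 0 \<and> drop_height k = 0 \<or> 1 \<le> real k \<and> - 1 < drop_height k \<and> drop_height k \<le> 0"
  using drop_height_bounds[of k] drop_height_0 by (cases k) auto

text \<open>Upper arm, outer side and lower arm; their convexity yields both regularity and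
  connectedness of the half ring.\<close>

lemma ringR_eq: "ringR k = slab (drop_height k) (real k + 1) (real k) (real k + 1)
    \<union> slab (real k) (real k + 1) (- real k - 1) (real k + 1)
    \<union> slab (drop_height k) (real k + 1) (- real k - 1) (- real k)"
proof -
  have "(c \<le> max \<bar>u\<bar> \<bar>v\<bar> \<and> max \<bar>u\<bar> \<bar>v\<bar> \<le> c + 1) \<and> h \<le> u \<longleftrightarrow>
      (h \<le> u \<and> u \<le> c + 1 \<and> c \<le> v \<and> v \<le> c + 1) \<or> (c \<le> u \<and> u \<le> c + 1 \<and> - c - 1 \<le> v \<and> v \<le> c + 1) \<or>
      (h \<le> u \<and> u \<le> c + 1 \<and> - c - 1 \<le> v \<and> v \<le> - c)"
    if "c = 0 \<and> h = 0 \<or> 1 \<le> c \<and> - 1 < h \<and> h \<le> 0" for u v c h :: real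
    using that by (smt (verit))
  from this[OF height_cases] show ?thesis
    by (auto simp only: ringR_def ring_def radius_def mem_slab mem_Collect_eq Un_iff set_eq_iff)
qed

lemma ringL_eq: "ringL k = slab (- real k - 1) (drop_height k) (real k) (real k + 1)
    \<union> slab (- real k - 1) (- real k) (- real k - 1) (real k + 1)
    \<union> slab (- real k - 1) (drop_height k) (- real k - 1) (- real k)"
proof -
  have "(c \<le> max \<bar>u\<bar> \<bar>v\<bar> \<and> max \<bar>u\<bar> \<bar>v\<bar> \<le> c + 1) \<and> u \<le> h \<longleftrightarrow>
      (- c - 1 \<le> u \<and> u \<le> h \<and> c \<le> v \<and> v \<le> c + 1) \<or> (- c - 1 \<le> u \<and> u \<le> - c \<and> - c - 1 \<le> v \<and> v \<le> c + 1) \<or>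
      (- c - 1 \<le> u \<and> u \<le> h \<and> - c - 1 \<le> v \<and> v \<le> - c)"
    if "c = 0 \<and> h = 0 \<or> 1 \<le> c \<and> - 1 < h \<and> h \<le> 0" for u v c h :: real
    using that by (smt (verit))
  from this[OF height_cases] show ?thesis
    by (auto simp only: ringL_def ring_def radius_def mem_slab mem_Collect_eq Un_iff set_eq_iff)
qed

lemma closure_interior_rings:
  "closure (interior (ringR k)) = ringR k" "closure (interior (ringL k)) = ringL k"
  "closure (interior (top_side k)) = top_side k" "closure (interior (bot_side k)) = bot_side k"
  unfolding ringR_eq ringL_eq top_side_def bot_side_def using drop_height_bounds[of k]
  by (auto intro!: closure_interior_Un closure_interior_slab)

lemma closure_interior_ring: "closure (interior (ring k)) = ring k"
  unfolding ring_split by (intro closure_interior_Un closure_interior_rings)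

lemma connected_rings: "connected (ringR k)" "connected (ringL k)" "connected (top_side k)" "connected (bot_side k)"
proof -
  have slabs: "connected (slab y1 y2 z1 z2)" for y1 y2 z1 z2
    by (intro convex_connected convex_slab)
  then show "connected (top_side k)" "connected (bot_side k)" by (auto simp: top_side_def bot_side_def)
  note h = drop_height_bounds[of k]
  have "point (real k + 1) (real k + 1) \<in> slab (drop_height k) (real k + 1) (real k) (real k + 1)
      \<inter> slab (real k) (real k + 1) (- real k - 1) (real k + 1)"
    "point (real k + 1) (- real k - 1) \<in> slab (real k) (real k + 1) (- real k - 1) (real k + 1)
      \<inter> slab (drop_height k) (real k + 1) (- real k - 1) (- real k)"
    using h by (auto simp: mem_slab)
  then show "connected (ringR k)" unfolding ringR_eq by (intro connected_Un slabs) blast+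
  have "point (- real k - 1) (real k + 1) \<in> slab (- real k - 1) (drop_height k) (real k) (real k + 1)
      \<inter> slab (- real k - 1) (- real k) (- real k - 1) (real k + 1)"
    "point (- real k - 1) (- real k - 1) \<in> slab (- real k - 1) (- real k) (- real k - 1) (real k + 1)
      \<inter> slab (- real k - 1) (drop_height k) (- real k - 1) (- real k)"
    using h by (auto simp: mem_slab)
  then show "connected (ringL k)" unfolding ringL_eq by (intro connected_Un slabs) blast+
qed

text \<open>Contact points at radius \<open>k + 1\<close>: the first two will lie in the half-spaces
  \<open>s\<close> and \<open>t\<close>, the next four link half rings to the top and bottom sides,
  and the last links the right half to the next ring.\<close>

lemma points_mem:
  "point (real k + 1) 0 \<in> ringR k" "point (- real k - 1) 0 \<in> ringL k"
  "point 0 (real k + 1) \<in> ringR k \<inter> top_side k" "point 0 (- real k - 1) \<in> ringR k \<inter> bot_side k"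
  "point (- 1) (real k + 1) \<in> ringL k \<inter> top_side k" "point (- 1) (- real k - 1) \<in> ringL k \<inter> bot_side k"
  "point (real k + 1) 0 \<in> ring (Suc k)"
  using drop_height_bounds[of k]
  by (auto simp: ringR_def ringL_def ring_def radius_def top_side_def bot_side_def mem_slab)

lemma connected_ring: "connected (ring k)"
proof -
  have "point (drop_height k) (real k + 1) \<in> ringR k \<inter> ringL k"
    using drop_height_bounds[of k] by (auto simp: ringR_def ringL_def ring_def radius_def)
  then show ?thesis unfolding ring_split by (intro connected_Un connected_rings) auto
qed

lemma ring_Int: 
  assumes "x \<in> ring j" "x \<in> ring k"
  shows "j = k \<or> (k = Suc j \<and> radius x = real k) \<or> (j = Suc k \<and> radius x = real j)"
proof -
  consider "j = k" | "Suc j \<le> k" | "Suc k \<le> j" by linarith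
  then show ?thesis using assms by cases (auto simp: ring_def)
qed

lemma ring_exhaust: "\<exists>k. x \<in> ring k"
proof -
  have "0 \<le> radius x" by (auto simp: radius_def)
  then have "x \<in> ring (nat \<lfloor>radius x\<rfloor>)"
    by (simp add: ring_def)
  then show ?thesis by blast
qed

section \<open>Null overlaps and disjoint layers\<close>

definition grid :: "(real^'n) set"
  where "grid = {x. x $ a \<in> \<rat> \<or> x $ b \<in> \<rat>}"

text \<open>\<open>grid\<close> is a countable union of hyperplanes, hence null, and a nonempty open
  set is not. Overlaps of different layers, and of left and right halves, lie in
  \<open>grid\<close>, so the corresponding products vanish.\<close>

lemma interior_subset_grid:
  assumes "S \<subseteq> grid"
  shows "interior S = {}"
proof -
  have *: "negligible {x::real^'n. x $ i \<in> \<rat>}" for i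
  proof -
    have "negligible {x::real^'n. x $ i = q}" for q
      using negligible_standard_hyperplane[of "axis i 1 :: real^'n" q]
      by (simp add: inner_axis axis_in_Basis_iff)
    then have "negligible (\<Union>q\<in>\<rat>. {x::real^'n. x $ i = q})"
      by (intro negligible_countable_Union) (auto simp: countable_rat)
    moreover have "(\<Union>q\<in>\<rat>. {x::real^'n. x $ i = q}) = {x. x $ i \<in> \<rat>}" by auto
    ultimately show ?thesis by simp
  qed
  have "grid = {x. x $ a \<in> \<rat>} \<union> {x. x $ b \<in> \<rat>}" by (auto simp: grid_def)
  then have "negligible grid" using * by simp
  then have "negligible (interior S)"
    using assms interior_subset negligible_subset by blast
  then show ?thesis using open_not_negligible by blast
qed

lemma radius_grid:
  assumes "radius x = real k"
  shows "x \<in> grid"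
proof -
  have "\<bar>x $ a\<bar> = real k \<or> \<bar>x $ b\<bar> = real k"
    using assms by (auto simp: radius_def max_def split: if_splits)
  then have "x $ a = real k \<or> x $ a = - real k \<or> x $ b = real k \<or> x $ b = - real k"
    by linarith
  then show ?thesis by (auto simp: grid_def)
qed

lemma layers_ring_Int_grid:
  assumes "i \<noteq> j"
  shows "layers ring i \<inter> layers ring j \<subseteq> grid"
proof
  fix x assume "x \<in> layers ring i \<inter> layers ring j"
  then obtain k l where "x \<in> ring k" "x \<in> ring l" "k mod 4 = i" "l mod 4 = j"
    by (auto simp: layers_def)
  with assms show "x \<in> grid" using ring_Int[of x k l] radius_grid by blast
qed

lemma layers_ringR_ringL_grid: "layers ringR i \<inter> layers ringL i \<subseteq> grid"
proof
  fix x assume "x \<in> layers ringR i \<inter> layers ringL i"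
  then obtain j k where jk: "x \<in> ringR j" "x \<in> ringL k" by (auto simp: layers_def)
  show "x \<in> grid"
  proof (cases "j = k")
    case True
    with jk have "x $ a = drop_height k" by (auto simp: ringR_def ringL_def)
    then show ?thesis using drop_height_Rats[of k] by (simp add: grid_def)
  next
    case False
    then show ?thesis using jk ring_subset ring_Int[of x j k] radius_grid by blast
  qed
qed

text \<open>Rings that meet have equal or consecutive indices. For \<open>i \<ge> 2\<close> the
  second layer is empty, no residue modulo 4 being \<open>i + 2\<close>.\<close>

lemma layers_ring_disjoint: "layers ring i \<inter> layers ring (i + 2) = {}"
proof -
  have False if "x \<in> ring j" "x \<in> ring k" "j mod 4 = i" "k mod 4 = i + 2" for x j k
  proof -
    have "j = k \<or> k = Suc j \<or> j = Suc k" using ring_Int[OF that(1,2)] by blast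
    then show False using that(3,4) by (elim disjE) (auto simp: mod_Suc split: if_splits)
  qed
  then show ?thesis by (auto simp: layers_def)
qed

text \<open>The residues leave only the case of a left half in the next outer ring. A common point
  would have \<open>a\<close>-coordinate at least \<open>drop_height j\<close> and at most
  \<open>drop_height (Suc j)\<close>, against strict decrease.\<close>

lemma layers_ringR_ringL_disjoint: "layers ringR i \<inter> layers ringL (Suc i mod 4) = {}"
proof -
  have False if x: "x \<in> ringR j" "x \<in> ringL k" and m: "j mod 4 = i" "k mod 4 = Suc i mod 4" for x j k
  proof -
    have "j = k \<or> k = Suc j \<or> j = Suc k" using x ring_subset ring_Int[of x j k] by blast
    moreover have "k mod 4 = Suc j mod 4" by (metis m mod_Suc_eq)
    moreover have "Suc k mod 4 \<noteq> k mod 4" "Suc (Suc k) mod 4 \<noteq> k mod 4" by (simp_all add: mod_Suc)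
    ultimately have "k = Suc j" by metis
    then show False using x drop_height_Suc[of j] by (auto simp: ringR_def ringL_def)
  qed
  then show ?thesis by (auto simp: layers_def)
qed

lemma layers_mono: "(\<And>k. F k \<subseteq> G k) \<Longrightarrow> layers F i \<subseteq> layers G i"
  by (auto simp: layers_def)

lemma regular_layers:
  assumes "\<And>k. closure (interior (F k)) = F k" "\<And>k. F k \<subseteq> ring k"
  shows "closure (interior (layers F i)) = layers F i"
proof (rule closure_interior_layers[OF assms(1)])
  show "continuous_on UNIV radius"
    unfolding radius_def by (intro continuous_intros)
  show "real k \<le> radius x" if "x \<in> F k" for k x
    using assms(2) that by (auto simp: ring_def)
qed

section \<open>The satisfying interpretation\<close>

definition quadrant :: "real \<Rightarrow> real \<Rightarrow> (real^'n) set"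
  where "quadrant e f = {x. 1 \<le> e * x $ a \<and> 1 \<le> f * x $ b}"

lemma quadrant:
  assumes "e = 1 \<or> e = - 1" "f = 1 \<or> f = - 1"
  shows "closure (interior (quadrant e f)) = quadrant e f" "connected (quadrant e f)"
proof -
  have eq: "quadrant e f = {x. 1 \<le> e * x $ a} \<inter> {x. 1 \<le> f * x $ b}" by (auto simp: quadrant_def)
  have neg: "{x::real^'n. 1 \<le> - (x $ i)} = {x. x $ i \<le> - 1}" "{x::real^'n. 1 < - (x $ i)} = {x. x $ i < - 1}" for i
    by auto
  have half: "closed {x::real^'n. 1 \<le> e * x $ i}" "convex {x::real^'n. 1 \<le> e * x $ i}" "open {x::real^'n. 1 < e * x $ i}"
    if "e = 1 \<or> e = - 1" for e :: real and i
    using that halfspaces[where c = 1 and i = i] halfspaces[where c = "- 1" and i = i]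
    by (auto simp: neg)
  have c: "convex (quadrant e f)" unfolding eq by (intro convex_Int half assms)
  then show "connected (quadrant e f)" by (rule convex_connected)
  have "{x. 1 < e * x $ a} \<inter> {x. 1 < f * x $ b} \<subseteq> interior (quadrant e f)"
    by (intro interior_maximal open_Int half assms) (auto simp: quadrant_def)
  moreover have "point (2 * e) (2 * f) \<in> {x. 1 < e * x $ a} \<inter> {x. 1 < f * x $ b}" using assms by auto
  ultimately have "interior (quadrant e f) \<noteq> {}" by blast
  moreover have "closed (quadrant e f)" unfolding eq by (intro closed_Int half assms)
  ultimately show "closure (interior (quadrant e f)) = quadrant e f" by (intro closure_interior_convex c)
qed

lemma phi_c_inf_satisfiable:
  "\<exists>r rp sv tv s t. rc_interp (euclidean :: (real^'n) topology) r rp sv tv s t \<and>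
     phi_c_inf euclidean r rp sv tv s t"
proof -
  define r p q where "r = layers ring" and "p = layers ringR" and "q = layers ringL"
  \<comment> \<open>\<open>s\<close> meets every right half ring and no left one; \<open>t\<close>
    meets every left half ring and no right one.\<close>
  define s t :: "(real^'n) set" where "s = {x. 1 \<le> x $ a}" and "t = {x. x $ a \<le> - 1}"
  \<comment> \<open>The \<open>sv\<close> for opposite indices run through opposite sides of the rings, hence do not meet;
    likewise the \<open>tv\<close>.\<close>
  define sv where "sv i = (if i < 2 then layers top_side i \<union> quadrant (- 1) 1
      else layers bot_side i \<union> quadrant (- 1) (- 1))" for i
  define tv where "tv i = (if i < 2 then layers top_side i \<union> quadrant 1 1
      else layers bot_side i \<union> quadrant 1 (- 1))" for i
  have rpq: "r i = p i \<union> q i" for i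
    unfolding r_def p_def q_def layers_Un[symmetric] ring_split[symmetric] by simp
  have reg: "closure (interior (r i)) = r i" "closure (interior (p i)) = p i"
    "closure (interior (q i)) = q i" for i
    unfolding r_def p_def q_def
    by (intro regular_layers closure_interior_ring closure_interior_rings ring_subset order_refl)+
  have reg_st: "closure (interior s) = s" "closure (interior t) = t"
  proof -
    have "{x. 1 < x $ a} \<subseteq> interior s" "{x. x $ a < - 1} \<subseteq> interior t"
      unfolding s_def t_def by (intro interior_maximal halfspaces; auto)+
    moreover have "point 2 0 \<in> {x. 1 < x $ a}" "point (- 2) 0 \<in> {x. x $ a < - 1}" by auto
    ultimately have "interior s \<noteq> {}" "interior t \<noteq> {}" by blast+
    then show "closure (interior s) = s" "closure (interior t) = t"
      unfolding s_def t_def by (intro closure_interior_convex halfspaces; simp)+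
  qed
  have reg_v: "closure (interior (sv i)) = sv i" "closure (interior (tv i)) = tv i" for i
    unfolding sv_def tv_def
    by (auto intro!: closure_interior_Un regular_layers closure_interior_rings ring_subset quadrant)
  have cl: "closed S" if "closure (interior S) = S" for S :: "(real^'n) set"
    using that by (metis closed_closure)
  note closeds = reg[THEN cl] reg_st[THEN cl] reg_v[THEN cl]
  have q_eq: "rc_times euclidean (r i) (rc_minus euclidean (p i)) = q i" for i
    unfolding rpq
    by (intro rc_times_rc_minus_euclidean reg interior_subset_grid)
      (simp add: p_def q_def layers_ringR_ringL_grid)
  have st: "connected s" "connected t"
    unfolding s_def t_def by (intro convex_connected halfspaces)+
  have ne: "p i \<noteq> {}" "q i \<noteq> {}" if "i \<le> 3" for i
  proof -
    have "i mod 4 = i" using that by simp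
    then show "p i \<noteq> {}" "q i \<noteq> {}"
      using points_mem(1,2)[of i] unfolding p_def q_def layers_def by blast+
  qed
  have ne_st: "s \<noteq> {}" "t \<noteq> {}"
  proof -
    have "point 1 0 \<in> s" "point (- 1) 0 \<in> t" by (auto simp: s_def t_def)
    then show "s \<noteq> {}" "t \<noteq> {}" by blast+
  qed
  have con_ps: "connected (p i \<union> s)" for i
    unfolding p_def
  proof (rule connected_layers_Un[OF st(1) connected_rings(1)])
    show "ringR k \<inter> s \<noteq> {}" for k using points_mem(1)[of k] by (force simp: s_def)
  qed
  have con_qt: "connected (q i \<union> t)" for i
    unfolding q_def
  proof (rule connected_layers_Un[OF st(2) connected_rings(2)])
    show "ringL k \<inter> t \<noteq> {}" for k using points_mem(2)[of k] by (force simp: t_def)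
  qed
  \<comment> \<open>Each right half is prolonged to the left by its top or bottom side, and a
    quadrant disjoint from all the \<open>p j\<close> joins the far ends.\<close>
  have con_psv: "connected (p i \<union> sv i)" for i
  proof -
    have "connected (layers (\<lambda>k. ringR k \<union> top_side k) i \<union> quadrant (- 1) 1)"
    proof (rule connected_layers_Un)
      show "connected (ringR k \<union> top_side k)" for k
        using points_mem(3)[of k] by (intro connected_Un connected_rings) blast
      have "point (- real k - 1) (real k + 1) \<in> top_side k \<inter> quadrant (- 1) 1" for k
        by (auto simp: top_side_def mem_slab quadrant_def)
      then show "(ringR k \<union> top_side k) \<inter> quadrant (- 1) 1 \<noteq> {}" for k by blast
    qed (simp add: quadrant)
    moreover have "connected (layers (\<lambda>k. ringR k \<union> bot_side k) i \<union> quadrant (- 1) (- 1))"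
    proof (rule connected_layers_Un)
      show "connected (ringR k \<union> bot_side k)" for k
        using points_mem(4)[of k] by (intro connected_Un connected_rings) blast
      have "point (- real k - 1) (- real k - 1) \<in> bot_side k \<inter> quadrant (- 1) (- 1)" for k
        by (auto simp: bot_side_def mem_slab quadrant_def)
      then show "(ringR k \<union> bot_side k) \<inter> quadrant (- 1) (- 1) \<noteq> {}" for k by blast
    qed (simp add: quadrant)
    ultimately show ?thesis by (simp add: p_def sv_def layers_Un Un_assoc)
  qed
  have con_qtv: "connected (q i \<union> tv i)" for i
  proof -
    have "connected (layers (\<lambda>k. ringL k \<union> top_side k) i \<union> quadrant 1 1)"
    proof (rule connected_layers_Un)
      show "connected (ringL k \<union> top_side k)" for k
        using points_mem(5)[of k] by (intro connected_Un connected_rings) blast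
      have "point (real k + 1) (real k + 1) \<in> top_side k \<inter> quadrant 1 1" for k
        by (auto simp: top_side_def mem_slab quadrant_def)
      then show "(ringL k \<union> top_side k) \<inter> quadrant 1 1 \<noteq> {}" for k by blast
    qed (simp add: quadrant)
    moreover have "connected (layers (\<lambda>k. ringL k \<union> bot_side k) i \<union> quadrant 1 (- 1))"
    proof (rule connected_layers_Un)
      show "connected (ringL k \<union> bot_side k)" for k
        using points_mem(6)[of k] by (intro connected_Un connected_rings) blast
      have "point (real k + 1) (- real k - 1) \<in> bot_side k \<inter> quadrant 1 (- 1)" for k
        by (auto simp: bot_side_def mem_slab quadrant_def)
      then show "(ringL k \<union> bot_side k) \<inter> quadrant 1 (- 1) \<noteq> {}" for k by blast
    qed (simp add: quadrant)
    ultimately show ?thesis by (simp add: q_def tv_def layers_Un Un_assoc)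
  qed
  \<comment> \<open>Every ring reaches \<open>t\<close>, and the right half of ring \<open>k\<close>
    touches ring \<open>k + 1\<close> on their common boundary.\<close>
  have con_prt: "connected (p i \<union> r ((i + 1) mod 4) \<union> t)" if "i \<le> 3" for i
  proof -
    let ?j = "(i + 1) mod 4"
    have "ring k \<inter> t \<noteq> {}" for k
      using points_mem(2)[of k] ring_subset(2)[of k] by (force simp: t_def)
    then have rt: "connected (layers ring ?j \<union> t)"
      by (intro connected_layers_Un st connected_ring)
    \<comment> \<open>\<open>connected_layers_Un\<close> asks every index to meet the hub. Outside
      the class of \<open>i\<close> the default \<open>t\<close> does so, without entering the
      union.\<close>
    let ?F = "\<lambda>k. if k mod 4 = i then ringR k else t"
    have "connected (layers ?F i \<union> (layers ring ?j \<union> t))"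
    proof (rule connected_layers_Un[OF rt])
      show "connected (?F k)" for k by (simp add: st connected_rings)
      show "?F k \<inter> (layers ring ?j \<union> t) \<noteq> {}" for k
      proof (cases "k mod 4 = i")
        case True
        then have "Suc k mod 4 = ?j" by (metis Suc_eq_plus1 mod_Suc_eq)
        then have "ring (Suc k) \<subseteq> layers ring ?j" unfolding layers_def by blast
        then show ?thesis using True points_mem(1,7)[of k] by auto
      qed (use ne_st in auto)
    qed
    moreover have "layers ?F i = layers ringR i" by (auto simp: layers_def)
    ultimately show ?thesis by (simp add: p_def r_def Un_assoc)
  qed
  have p_right: "- 1 < x $ a" if "x \<in> p i" for x i
  proof -
    obtain k where "x \<in> ringR k" using \<open>x \<in> p i\<close> by (auto simp: p_def layers_def)
    then show ?thesis using drop_height_bounds(1)[of k] by (simp add: ringR_def)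
  qed
  have q_left: "x $ a \<le> 0" if "x \<in> q i" for x i
  proof -
    obtain k where "x \<in> ringL k" using \<open>x \<in> q i\<close> by (auto simp: q_def layers_def)
    then show ?thesis using drop_height_bounds(2)[of k] by (simp add: ringL_def)
  qed
  \<comment> \<open>\<open>s\<close> and \<open>t\<close> contribute no intersections, so the
    clauses of (2) and (6) with \<open>s\<close> and \<open>t\<close> reduce to disjointness of
    \<open>p i\<close> and \<open>q j\<close>.\<close>
  have ps_qt: "(p i \<union> s) \<inter> (q j \<union> t) = {}" if "p i \<inter> q j = {}" for i j
  proof -
    have "p i \<inter> t = {}" using p_right by (force simp: t_def)
    moreover have "s \<inter> q j = {}" using q_left by (force simp: s_def)
    moreover have "s \<inter> t = {}" by (auto simp: s_def t_def)
    ultimately show ?thesis using that by blast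
  qed
  have notC_ps_qt: "notC euclidean (p i \<union> s) (q j \<union> t)" if "p i \<inter> q j = {}" for i j
    by (intro notC_euclideanI con_ps con_qt closed_Un closeds ps_qt[OF that]) (use ne_st in auto)
  have r_disj: "r i \<inter> r (i + 2) = {}" for i
    unfolding r_def by (rule layers_ring_disjoint)
  have tb: "layers top_side i \<subseteq> r i" "layers bot_side i \<subseteq> r i" for i
    unfolding r_def by (intro layers_mono ring_subset)+
  have tb2: "0 \<le> x $ b" if "x \<in> layers top_side i" for x i
    using that by (auto simp: layers_def top_side_def mem_slab)
  have tb3: "x $ b \<le> 0" if "x \<in> layers bot_side i" for x i
    using that by (auto simp: layers_def bot_side_def mem_slab)
  \<comment> \<open>These quadrants lie to the left of all the \<open>p j\<close>, and the sign of
    \<open>x $ b\<close> separates upper from lower pieces where a quadrant is involved. All other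
    pairs lie in the disjoint sets \<open>r i\<close> and \<open>r (i + 2)\<close>.\<close>
  have sv_disj: "(p i \<union> sv i) \<inter> (p (i + 2) \<union> sv (i + 2)) = {}" if "i < 2" for i
  proof -
    have "quadrant (- 1) f \<inter> p j = {}" for f j using p_right by (force simp: quadrant_def)
    moreover have "quadrant (- 1) 1 \<inter> layers bot_side (i + 2) = {}"
      using tb3 by (force simp: quadrant_def)
    moreover have "layers top_side i \<inter> quadrant (- 1) (- 1) = {}"
      using tb2 by (force simp: quadrant_def)
    moreover have "quadrant (- 1) 1 \<inter> quadrant (- 1) (- 1) = {}" by (auto simp: quadrant_def)
    moreover have "sv i = layers top_side i \<union> quadrant (- 1) 1"
      "sv (i + 2) = layers bot_side (i + 2) \<union> quadrant (- 1) (- 1)" using that by (auto simp: sv_def)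
    ultimately show ?thesis using r_disj[of i] rpq[of i] rpq[of "i + 2"] tb(1)[of i] tb(2)[of "i + 2"]
      by blast
  qed
  have tv_disj: "(q i \<union> tv i) \<inter> (q (i + 2) \<union> tv (i + 2)) = {}" if "i < 2" for i
  proof -
    have "quadrant 1 f \<inter> q j = {}" for f j using q_left by (force simp: quadrant_def)
    moreover have "quadrant 1 1 \<inter> layers bot_side (i + 2) = {}"
      using tb3 by (force simp: quadrant_def)
    moreover have "layers top_side i \<inter> quadrant 1 (- 1) = {}"
      using tb2 by (force simp: quadrant_def)
    moreover have "quadrant 1 1 \<inter> quadrant 1 (- 1) = {}" by (auto simp: quadrant_def)
    moreover have "tv i = layers top_side i \<union> quadrant 1 1"
      "tv (i + 2) = layers bot_side (i + 2) \<union> quadrant 1 (- 1)" using that by (auto simp: tv_def)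
    ultimately show ?thesis using r_disj[of i] rpq[of i] rpq[of "i + 2"] tb(1)[of i] tb(2)[of "i + 2"]
      by blast
  qed
  have sum: "r 0 \<union> r 1 \<union> r 2 \<union> r 3 = UNIV" and s_sub: "s \<subseteq> p 0 \<union> p 1 \<union> p 2 \<union> p 3"
  proof -
    have "x \<in> r 0 \<union> r 1 \<union> r 2 \<union> r 3" for x
    proof -
      obtain k where "x \<in> ring k" using ring_exhaust by blast
      then have "x \<in> r (k mod 4)" by (auto simp: r_def layers_def)
      moreover have "k mod 4 = 0 \<or> k mod 4 = 1 \<or> k mod 4 = 2 \<or> k mod 4 = 3" by presburger
      ultimately show ?thesis by (elim disjE) simp_all
    qed
    then show "r 0 \<union> r 1 \<union> r 2 \<union> r 3 = UNIV" by blast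
    moreover have "s \<inter> q i = {}" for i using q_left by (force simp: s_def)
    ultimately show "s \<subseteq> p 0 \<union> p 1 \<union> p 2 \<union> p 3" unfolding rpq by blast
  qed
  have con_p: "connected (p 0 \<union> p 1 \<union> p 2 \<union> p 3)"
  proof -
    \<comment> \<open>Adding \<open>s\<close> makes the four connected sets overlap without changing
      the union, which already contains \<open>s\<close>.\<close>
    have "connected ((p 0 \<union> s) \<union> (p 1 \<union> s) \<union> (p 2 \<union> s) \<union> (p 3 \<union> s))"
      using ne_st by (intro connected_Un con_ps) auto
    moreover have "(p 0 \<union> s) \<union> (p 1 \<union> s) \<union> (p 2 \<union> s) \<union> (p 3 \<union> s) = p 0 \<union> p 1 \<union> p 2 \<union> p 3"
      using s_sub by blast
    ultimately show ?thesis by simp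
  qed
  have notC_p_t: "notC euclidean (p 0 \<union> p 1 \<union> p 2 \<union> p 3) t"
  proof (intro notC_euclideanI con_p st closed_Un closeds ne_st)
    show "(p 0 \<union> p 1 \<union> p 2 \<union> p 3) \<inter> t = {}" using p_right by (force simp: t_def)
  qed (use ne[of 0] in auto)
  have notC_comm: "notC euclidean X Y \<Longrightarrow> notC euclidean Y X" for X Y :: "(real^'n) set"
    by (simp add: notC_def rc_plus_def Un_commute)
  have "rc_interp euclidean r p sv tv s t"
    unfolding rc_interp_def regular_closed_in_def by (simp add: reg reg_st reg_v)
  moreover have "phi_c_inf euclidean r p sv tv s t"
    unfolding phi_c_inf_def q_eq rc_plus_def topspace_euclidean connectedin_iff_connected
  proof (intro conjI allI impI ballI)
    show "r 0 \<union> r 1 \<union> r 2 \<union> r 3 = UNIV" by (rule sum)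
    show "rc_times euclidean (r i) (r j) = {}" if "i < j \<and> j \<le> 3" for i j
    proof -
      have "interior (r i \<inter> r j) = {}"
        using that by (intro interior_subset_grid) (simp add: r_def layers_ring_Int_grid)
      then show ?thesis by (simp add: rc_times_def)
    qed
    show "r i \<noteq> {}" if "i \<le> 3" for i using ne[OF that] by (simp add: rpq)
    fix i :: nat assume i: "i \<in> {0,1}"
    then have i2: "i < 2" by auto
    have "p (i + 2) \<inter> q i = {}" "p i \<inter> q (i + 2) = {}" using r_disj[of i] unfolding rpq by blast+
    then show "notC euclidean (q i \<union> t) (p (i + 2) \<union> s)" "notC euclidean (p i \<union> s) (q (i + 2) \<union> t)"
      by (auto intro: notC_ps_qt notC_comm)
    show "notC euclidean (p i \<union> sv i) (p (i + 2) \<union> sv (i + 2))"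
      using ne(1)[of i] ne(1)[of "i + 2"] i2
      by (intro notC_euclideanI con_psv closed_Un closeds sv_disj) auto
    show "notC euclidean (q i \<union> tv i) (q (i + 2) \<union> tv (i + 2))"
      using ne(2)[of i] ne(2)[of "i + 2"] i2
      by (intro notC_euclideanI con_qtv closed_Un closeds tv_disj) auto
  next
    fix i :: nat assume i: "i \<le> 3"
    show "p i \<noteq> {}" using ne i by blast
    have "p i \<inter> r i = p i" by (auto simp: rpq)
    then show "rc_le euclidean (p i) (r i)"
      by (simp add: rc_le_def rc_times_def reg)
    show "connected (p i \<union> r ((i + 1) mod 4) \<union> t)" by (rule con_prt[OF i])
    have "p i \<inter> q ((i + 1) mod 4) = {}"
      using layers_ringR_ringL_disjoint[of i] by (simp add: p_def q_def)
    then show "notC euclidean (p i \<union> s) (q ((i + 1) mod 4) \<union> t)" by (rule notC_ps_qt)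
  qed (use ne_st notC_p_t in auto)
  ultimately show ?thesis by blast
qed

end

lemma phi_c_inf_satisfiable_euclidean:
  assumes "CARD('n::finite) \<ge> 2"
  shows "\<exists>r rp sv tv s t. rc_interp (euclidean :: (real^'n) topology) r rp sv tv s t \<and>
     phi_c_inf euclidean r rp sv tv s t"
proof -
  obtain a b :: 'n where "a \<noteq> b"
    using assms by (metis UNIV_I card_2_iff' card_le_Suc0_iff_eq finite_class.finite_UNIV not_less_eq_eq numeral_2_eq_2)
  then interpret two_coordinates a b by unfold_locales
  show ?thesis by (rule phi_c_inf_satisfiable)
qed

theorem theorem3p3:
  shows "(CARD('n::finite) \<ge> 2 \<longrightarrow>
           (\<exists>r rp sv tv s t. rc_interp (euclidean :: (real^'n) topology) r rp sv tv s t \<and>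
                             phi_c_inf euclidean r rp sv tv s t))
       \<and> (\<forall>(T::'a topology) r rp sv tv s t.
             locally_connected_space T \<and> unicoherent_space T \<and>
             rc_interp T r rp sv tv s t \<and> phi_c_inf T r rp sv tv s t \<longrightarrow>
             (\<exists>i\<le>3. infinitely_many_components T (r i) \<or> infinitely_many_components T (rp i) \<or>
                      infinitely_many_components T (sv i) \<or> infinitely_many_components T (tv i))
             \<or> infinitely_many_components T s \<or> infinitely_many_components T t)"
  using phi_c_inf_satisfiable_euclidean phi_c_inf_infinitely_many_components by blast

end
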